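(* Let $Y_{\mathcal A}$ be the admittance matrix of a connected electrical network with boundary nodes $\{1,\dots,N\}$, and let $Y$ be its Kron-reduced admittance matrix. The following statements are equivalent: (i) The original electrical network has no shunt elements, i.e. $y_m=0$ for all $m\in\mathcal A$ (equivalently $Y_{\mathcal A}\mathbf 1=\mathbf 0$). (ii) The Kron-reduced network has no shunt elements, i.e. $Y\mathbf 1=\mathbf 0$.
   Context: Network. A connected undirected graph has finite node set $\mathcal A$ and edge (branch) set $\mathcal E$; $\mathcal N=\{1,\dots,N\}\subseteq\mathcal A$ are the boundary nodes and $\mathcal I=\mathcal A\setminus\mathcal N$ the interior nodes. Each branch $(m,n)\in\mathcal E$ has a nonzero admittance $y_{mn}=y_{nm}\in\mathbb C$ and each node $m$ has a shunt admittance $y_m\in\mathbb C$ to ground, with $y_m=0$ for $m\in\mathcal N$. The admittance matrix $Y_{\mathcal A}\in\mathbb C^{|\mathcal A|\times|\mathcal A|}$ has entries $[Y_{\mathcal A}]_{mm}=y_m+\sum_{(m,k)\in\mathcal E}y_{mk}$, $[Y_{\mathcal A}]_{mn}=-y_{mn}$ if $(m,n)\in\mathcal E$, and $0$ otherwise. Write $$Y_{\mathcal A}=\begin{bmatrix}Y_{\mathcal{NN}}&Y_{\mathcal{NI}}\\ Y_{\mathcal{NI}}^{\mathrm T}&Y_{\mathcal{II}}\end{bmatrix},\qquad Y:=Y_{\mathcal{NN}}-Y_{\mathcal{NI}}Y_{\mathcal{II}}^{-1}Y_{\mathcal{NI}}^{\mathrm T}\in\mathbb C^{N\times N},$$ where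 $Y$ is the Kron-reduced admittance matrix. The Kron-reduced network is the network on $\{1,\dots,N\}$ with admittance matrix $Y$: its branch admittances are $-Y_{nm}$ and its shunt admittances are the row sums of $Y$. Standing assumption: all proper principal submatrices of $Y_{\mathcal A}$ are nonsingular, and $Y_{\mathcal A}$ itself is nonsingular whenever at least one shunt admittance is nonzero. *)

theory Defs
  imports
    Complex_Main
    "Graph_Theory.Pair_Digraph"
    "Graph_Theory.Digraph_Component"
    "Jordan_Normal_Form.Gauss_Jordan_Elimination"
    "Jordan_Normal_Form.DL_Submatrix"
begin

text \<open>
  Nodes are numbered \<open>0, \<dots>, M - 1\<close>, with the boundary nodes \<open>0, \<dots>, N - 1\<close> first, so that
  they match matrix indices. Graphs are represented as symmetric loop-free digraphs: an undirected
  branch between \<open>m\<close> and \<open>n\<close> is the pair of arcs \<open>(m, n)\<close>, \<open>(n, m)\<close>. The values of \<open>y\<close>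
  outside the branch set and of \<open>s\<close> outside the node set are irrelevant.
\<close>

locale electrical_network = pair_graph G
  for G :: "nat pair_pre_digraph" +
  fixes M N :: nat
    and y :: "nat \<Rightarrow> nat \<Rightarrow> complex"
    and s :: "nat \<Rightarrow> complex"
  assumes nodes: "pverts G = {0..<M}"
    and boundary_nonempty: "0 < N"
    and boundary_subset: "N \<le> M"
    and connected: "Digraph_Component.connected (with_proj G)"
    and branch_nonzero: "(m, n) \<in> parcs G \<Longrightarrow> y m n \<noteq> 0"
    and branch_sym: "(m, n) \<in> parcs G \<Longrightarrow> y m n = y n m"
    and boundary_no_shunt: "m < N \<Longrightarrow> s m = 0"

definition admittance_matrix ::
  "nat pair_pre_digraph \<Rightarrow> nat \<Rightarrow> (nat \<Rightarrow> nat \<Rightarrow> complex) \<Rightarrow> (nat \<Rightarrow> complex) \<Rightarrow> complex mat" where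
  "admittance_matrix G M y s = mat M M (\<lambda>(m, n).
     if m = n then s m + (\<Sum>k | (m, k) \<in> parcs G. y m k)
     else if (m, n) \<in> parcs G then - y m n
     else 0)"

text \<open>
  The lower left block is not used: it is the transpose of the upper right one for symmetric \<open>A\<close>.
  If the lower right block is singular, \<open>mat_inverse\<close> returns \<open>None\<close> and the value is
  unspecified. The lower right block may be the \<open>0 \<times> 0\<close> matrix, which is its own inverse.
\<close>

definition kron_reduction :: "nat \<Rightarrow> complex mat \<Rightarrow> complex mat" where
  "kron_reduction N A =
     (case split_block A N N of (A_NN, A_NI, _, A_II) \<Rightarrow>
        A_NN - A_NI * the (mat_inverse A_II) * transpose_mat A_NI)"

text \<open>
  The shunt admittances of the network with a prescribed admittance matrix: since the branch
  admittances are \<open>- A $$ (m, n)\<close>, they are the row sums.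
\<close>

definition matrix_shunt :: "complex mat \<Rightarrow> nat \<Rightarrow> complex" where
  "matrix_shunt A n = (\<Sum>k<dim_col A. A $$ (n, k))"

definition ones_vec :: "nat \<Rightarrow> complex vec" where
  "ones_vec n = vec n (\<lambda>_. 1)"

end

theory Submission
  imports Defs
begin

text \<open>
  With \<open>C = Y\<^sub>N\<^sub>I\<close> and \<open>w = - Y\<^sub>I\<^sub>I\<^sup>-\<^sup>1 C\<^sup>T 1\<close>, block multiplication gives
  \<open>Y\<^sub>A (1, w) = (Y 1, 0)\<close>, while \<open>Y\<^sub>A 1\<close> is the vector of shunt admittances.
  If \<open>Y 1 = 0\<close>, then \<open>Y\<^sub>A\<close> has the nonzero kernel vector \<open>(1, w)\<close>, so the nonsingularity
  assumption leaves no shunts. If there are no shunts, then the interior rows of \<open>Y\<^sub>A 1 = 0\<close>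
  force \<open>w = 1\<close>, so the identity reads \<open>0 = (Y 1, 0)\<close>.
\<close>

lemma mult_ones_vec_index:
  assumes "n < dim_row A" "dim_col A = k"
  shows "(A *\<^sub>v ones_vec k) $ n = matrix_shunt A n"
  using assms by (auto simp: matrix_shunt_def ones_vec_def scalar_prod_def lessThan_atLeast0
      intro!: sum.cong)

lemma mult_ones_vec_eq_0_iff:
  assumes "A \<in> carrier_mat n k"
  shows "A *\<^sub>v ones_vec k = 0\<^sub>v n \<longleftrightarrow> (\<forall>i<n. matrix_shunt A i = 0)"
proof -
  have "A *\<^sub>v ones_vec k = 0\<^sub>v n \<longleftrightarrow> (\<forall>i<n. (A *\<^sub>v ones_vec k) $ i = 0)"
    using assms by (auto simp del: index_mult_mat_vec simp: vec_eq_iff)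
  then show ?thesis
    using assms by (simp add: mult_ones_vec_index del: index_mult_mat_vec)
qed

lemma ones_vec_carrier [simp]: "ones_vec n \<in> carrier_vec n"
  by (simp add: ones_vec_def)

lemma ones_vec_append: "ones_vec n @\<^sub>v ones_vec k = ones_vec (n + k)"
  by (rule eq_vecI) (auto simp: ones_vec_def)

lemma invertible_mat_mult_vec_eq_0:
  fixes A :: "'a :: comm_ring_1 mat"
  assumes "invertible_mat A" "A \<in> carrier_mat n n" "v \<in> carrier_vec n" "A *\<^sub>v v = 0\<^sub>v n"
  shows "v = 0\<^sub>v n"
proof -
  obtain B where B: "A * B = 1\<^sub>m n" "B * A = 1\<^sub>m (dim_row B)"
    using assms(1,2) by (auto simp: invertible_mat_def inverts_mat_def)
  \<comment> \<open>\<open>invertible_mat\<close> does not fix the shape of \<open>B\<close>: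
    comparing column counts in \<open>A * B = 1\<^sub>m n\<close> and in
    \<open>B * A = 1\<^sub>m (dim_row B)\<close> gives \<open>dim_col B = n\<close> and
    \<open>dim_row B = n\<close>.\<close>
  then have Bc: "B \<in> carrier_mat n n"
    using assms(2) by (metis carrier_matD(2) carrier_matI index_mult_mat(3) index_one_mat(3))
  have "v = (B * A) *\<^sub>v v"
    using B(2) Bc assms(3) by simp
  also have "\<dots> = B *\<^sub>v (A *\<^sub>v v)"
    using Bc assms(2,3) by simp
  also have "\<dots> = 0\<^sub>v n"
    using Bc assms(4) by (auto intro!: eq_vecI)
  finally show ?thesis .
qed

text \<open>Links nonsingularity as assumed of the network to the computed inverse in
  \<open>kron_reduction\<close>: \<open>mat_inverse\<close> yields \<open>None\<close> only off the
  units of the matrix ring, and an invertible matrix is such a unit.\<close>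

lemma mat_inverse_invertible_mat:
  fixes A :: "'a :: field mat"
  assumes inv: "invertible_mat A" and A: "A \<in> carrier_mat n n"
  shows "A * the (mat_inverse A) = 1\<^sub>m n" "the (mat_inverse A) * A = 1\<^sub>m n"
    "the (mat_inverse A) \<in> carrier_mat n n"
proof -
  obtain B where B: "A * B = 1\<^sub>m n" "B * A = 1\<^sub>m (dim_row B)"
    using assms by (auto simp: invertible_mat_def inverts_mat_def)
  then have "B \<in> carrier_mat n n"
    using A by (metis carrier_matD(2) carrier_matI index_mult_mat(3) index_one_mat(3))
  then have "A \<in> Units (ring_mat TYPE('a) n ())"
    using B A by (force simp: Units_def ring_mat_simps)
  then obtain C where "mat_inverse A = Some C"
    using mat_inverse(1)[OF A, where b = "()"] by blast
  then show "A * the (mat_inverse A) = 1\<^sub>m n" "the (mat_inverse A) * A = 1\<^sub>m n"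
    "the (mat_inverse A) \<in> carrier_mat n n"
    using mat_inverse(2)[OF A] by auto
qed

text \<open>Lets the assumption on principal submatrices reach the interior block, which
  \<open>split_block\<close> describes by shifted indices.\<close>

lemma submatrix_trailing:
  assumes "A \<in> carrier_mat (n + k) (n + k)"
  shows "submatrix A {n..<n + k} {n..<n + k} = mat k k (\<lambda>(i, j). A $$ (i + n, j + n))"
proof -
  have dim: "{i. i < n + k \<and> i \<in> {n..<n + k}} = {n..<n + k}"
    by auto
  \<comment> \<open>\<open>submatrix\<close> addresses an entry by its rank among the selected
    indices; the rank of \<open>i + n\<close> is \<open>i\<close>.\<close>
  have card: "card {a. n \<le> a \<and> a < n + k \<and> a < i + n} = i" if "i < k" for i
  proof -
    have "{a. n \<le> a \<and> a < n + k \<and> a < i + n} = {n..<i + n}"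
      using that by auto
    then show ?thesis by simp
  qed
  show ?thesis
  proof (rule eq_matI, goal_cases)
    case (1 i j)
    then show ?case
      using assms submatrix_index_card[of "i + n" A "j + n" "{n..<n + k}" "{n..<n + k}"]
      by (simp add: card)
  qed (use assms in \<open>simp_all add: dim_submatrix dim del: atLeastLessThan_iff\<close>)
qed

text \<open>Block elimination: the second component is chosen so that, by
  \<open>D * E = 1\<^sub>m k\<close>, the lower block row cancels; substituting it in the upper row
  leaves the Schur complement applied to \<open>u\<close>.\<close>

lemma schur_complement_mult_vec:
  fixes A :: "'a :: comm_ring_1 mat"
  assumes A: "A \<in> carrier_mat n n" and B: "B \<in> carrier_mat n k"
    and C: "C \<in> carrier_mat k n" and D: "D \<in> carrier_mat k k"
    and E: "E \<in> carrier_mat k k" and DE: "D * E = 1\<^sub>m k"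
    and u: "u \<in> carrier_vec n"
  shows "four_block_mat A B C D *\<^sub>v (u @\<^sub>v - (E *\<^sub>v (C *\<^sub>v u))) =
    (A - B * E * C) *\<^sub>v u @\<^sub>v 0\<^sub>v k"
proof -
  let ?z = "E *\<^sub>v (C *\<^sub>v u)"
  have z: "?z \<in> carrier_vec k"
    using C E u by auto
  have neg: "X *\<^sub>v - ?z = - (X *\<^sub>v ?z)" if "X \<in> carrier_mat m k" for X m
    using that E by (intro eq_vecI) auto
  have "D *\<^sub>v ?z = (D * E) *\<^sub>v (C *\<^sub>v u)"
    using C D E u by (intro assoc_mult_mat_vec[symmetric]) auto
  then have lower: "C *\<^sub>v u + D *\<^sub>v - ?z = 0\<^sub>v k"
    using C u DE neg[OF D] by (auto intro!: eq_vecI)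
  have "(A - B * E * C) *\<^sub>v u = A *\<^sub>v u - (B * E * C) *\<^sub>v u"
    using A B C E u by (intro minus_mult_distrib_mat_vec) auto
  also have "(B * E * C) *\<^sub>v u = (B * E) *\<^sub>v (C *\<^sub>v u)"
    using B C E u by (intro assoc_mult_mat_vec) auto
  also have "\<dots> = B *\<^sub>v ?z"
    using B C E u by (intro assoc_mult_mat_vec) auto
  finally have upper: "A *\<^sub>v u + B *\<^sub>v - ?z = (A - B * E * C) *\<^sub>v u"
    using A B u z neg[OF B] by (auto intro!: eq_vecI)
  show ?thesis
    using four_block_mat_mult_vec[OF A B C D u, of "- ?z"] z lower upper by simp
qed

context electrical_network
begin

lemma admittance_matrix_carrier: "admittance_matrix G M y s \<in> carrier_mat M M"
  by (simp add: admittance_matrix_def)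

lemma admittance_matrix_sym:
  assumes "m < M" "n < M"
  shows "admittance_matrix G M y s $$ (m, n) = admittance_matrix G M y s $$ (n, m)"
  using assms branch_sym arcs_symmetric by (auto simp: admittance_matrix_def)

text \<open>Each branch at \<open>m\<close> enters the diagonal entry with a plus sign and one
  off-diagonal entry with a minus sign, so only the shunt term survives in the row sum.\<close>

lemma matrix_shunt_admittance_matrix:
  assumes m: "m < M"
  shows "matrix_shunt (admittance_matrix G M y s) m = s m"
proof -
  let ?K = "{k. (m, k) \<in> parcs G}"
  have K: "?K \<subseteq> {..<M}"
    using in_arcsD2 nodes by auto
  \<comment> \<open>Without loops, all neighbours of \<open>m\<close> lie in the off-diagonal part
    of the row, so the cancellation is complete.\<close>
  have no_loop: "m \<notin> ?K"
    using pair_no_loops[of "(m, m)"] by auto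
  have "matrix_shunt (admittance_matrix G M y s) m =
      admittance_matrix G M y s $$ (m, m) +
      (\<Sum>k\<in>{..<M} - {m}. admittance_matrix G M y s $$ (m, k))"
    using m by (subst sum.remove[symmetric])
      (auto simp: matrix_shunt_def admittance_matrix_def)
  also have "(\<Sum>k\<in>{..<M} - {m}. admittance_matrix G M y s $$ (m, k)) = (\<Sum>k\<in>?K. - y m k)"
    using m K no_loop by (intro sum.mono_neutral_cong_right) (auto simp: admittance_matrix_def)
  finally show ?thesis
    using m by (simp add: admittance_matrix_def sum_negf)
qed

end

theorem theorem1:
  fixes G :: "nat pair_pre_digraph"
    and M N :: nat
    and y :: "nat \<Rightarrow> nat \<Rightarrow> complex"
    and s :: "nat \<Rightarrow> complex"
    and Y_A Y :: "complex mat"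
  assumes network: "electrical_network G M N y s"
    and Y_A_def: "Y_A = admittance_matrix G M y s"
    and Y_def: "Y = kron_reduction N Y_A"
    and proper_principal_nonsingular:
      "\<And>S. S \<noteq> {} \<Longrightarrow> S \<subset> {0..<M} \<Longrightarrow> invertible_mat (submatrix Y_A S S)"
    and shunt_nonsingular: "(\<exists>m<M. s m \<noteq> 0) \<Longrightarrow> invertible_mat Y_A"
  shows "((\<forall>m<M. s m = 0) \<longleftrightarrow> (\<forall>n<N. matrix_shunt Y n = 0)) \<and>
         ((\<forall>m<M. s m = 0) \<longleftrightarrow> Y_A *\<^sub>v ones_vec M = 0\<^sub>v M) \<and>
         ((\<forall>n<N. matrix_shunt Y n = 0) \<longleftrightarrow> Y *\<^sub>v ones_vec N = 0\<^sub>v N)"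
proof -
  interpret electrical_network G M N y s by (rule network)
  define L where "L = M - N"
  have M: "M = N + L"
    using boundary_subset by (simp add: L_def)
  have Y_A: "Y_A \<in> carrier_mat M M"
    unfolding Y_A_def by (rule admittance_matrix_carrier)
  obtain A B C D where split: "split_block Y_A N N = (A, B, C, D)"
    by (metis prod_cases4)
  have dims: "dim_row Y_A = N + L" "dim_col Y_A = N + L"
    using Y_A M by auto
  note blocks = split_block[OF split dims]
  \<comment> \<open>\<open>kron_reduction\<close> transposes the upper right block; symmetry of
    \<open>Y_A\<close> turns this into the lower left block that the Schur complement identity
    requires.\<close>
  have C_eq: "transpose_mat B = C"
    using split admittance_matrix_sym[folded Y_A_def] Y_A M
    by (auto simp: split_block_def Let_def intro!: eq_matI)
  have "invertible_mat D"
  \<comment> \<open>With no interior nodes, \<open>D\<close> is the empty matrix and its own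
    inverse; this case is separate because the assumption speaks of nonempty index sets.\<close>
  proof (cases "L = 0")
    case True
    then show ?thesis
      using blocks(4) by (auto simp: invertible_mat_def inverts_mat_def intro!: exI[of _ D] eq_matI)
  next
    case False
    have "D = submatrix Y_A {N..<M} {N..<M}"
      using split submatrix_trailing[of Y_A N L] Y_A M
      by (auto simp: split_block_def Let_def)
    \<comment> \<open>Node 0 is a boundary node, so the interior index set is a proper
      subset.\<close>
    moreover have "0 \<in> {0..<M} - {N..<M}" "{N..<M} \<noteq> {}"
      using boundary_nonempty M False by auto
    moreover from this(1) have "{N..<M} \<subset> {0..<M}"
      unfolding psubset_eq by (metis DiffD1 DiffD2 atLeastLessThan_iff le0 subsetI)
    ultimately show ?thesis
      using proper_principal_nonsingular by simp
  qed
  define E where "E = the (mat_inverse D)"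
  have DE: "D * E = 1\<^sub>m L" and ED: "E * D = 1\<^sub>m L" and E: "E \<in> carrier_mat L L"
    using mat_inverse_invertible_mat[OF \<open>invertible_mat D\<close> blocks(4)] by (simp_all add: E_def)
  have Y_eq: "Y = A - B * E * C"
    unfolding Y_def kron_reduction_def split by (simp add: E_def C_eq)
  have Y: "Y \<in> carrier_mat N N"
    using blocks E by (auto simp: Y_eq)
  \<comment> \<open>The interior voltages when all boundary nodes are held at voltage 1 and no
    current is injected at interior nodes.\<close>
  define w where "w = - (E *\<^sub>v (C *\<^sub>v ones_vec N))"
  have w: "w \<in> carrier_vec L"
    using blocks E by (auto simp: w_def)
  have key: "Y_A *\<^sub>v (ones_vec N @\<^sub>v w) = Y *\<^sub>v ones_vec N @\<^sub>v 0\<^sub>v L"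
    unfolding w_def Y_eq blocks(5)
    by (rule schur_complement_mult_vec[OF blocks(1-4) E DE]) simp
  have shunt_iff: "(\<forall>m<M. s m = 0) \<longleftrightarrow> Y_A *\<^sub>v ones_vec M = 0\<^sub>v M"
    using mult_ones_vec_eq_0_iff[OF Y_A] matrix_shunt_admittance_matrix by (simp add: Y_A_def)
  have zero_append: "0\<^sub>v M = 0\<^sub>v N @\<^sub>v 0\<^sub>v L"
    by (auto simp: M intro!: eq_vecI)
  have "(\<forall>m<M. s m = 0) \<longleftrightarrow> Y *\<^sub>v ones_vec N = 0\<^sub>v N"
  proof
    assume "\<forall>m<M. s m = 0"
    then have Y_A_ones: "Y_A *\<^sub>v ones_vec M = 0\<^sub>v M"
      using shunt_iff by simp
    have "Y_A *\<^sub>v ones_vec M =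
        (A *\<^sub>v ones_vec N + B *\<^sub>v ones_vec L) @\<^sub>v (C *\<^sub>v ones_vec N + D *\<^sub>v ones_vec L)"
      using four_block_mat_mult_vec[OF blocks(1-4) ones_vec_carrier ones_vec_carrier]
      by (simp add: blocks(5)[symmetric] ones_vec_append M)
    then have "C *\<^sub>v ones_vec N + D *\<^sub>v ones_vec L = 0\<^sub>v L"
      using Y_A_ones blocks(1,2)
        append_vec_eq[of "0\<^sub>v N" N "A *\<^sub>v ones_vec N + B *\<^sub>v ones_vec L"]
      unfolding zero_append by simp
    then have interior: "C *\<^sub>v ones_vec N = - (D *\<^sub>v ones_vec L)"
      using blocks(3,4) by (auto simp: vec_eq_iff add_eq_0_iff2 simp del: index_mult_mat_vec)
    \<comment> \<open>Here \<open>E\<close> must act as a left inverse of \<open>D\<close>: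
      \<open>E * D = 1\<^sub>m L\<close> solves the interior equation uniquely, by the all-ones
      vector.\<close>
    have "E *\<^sub>v (C *\<^sub>v ones_vec N) = - (E *\<^sub>v (D *\<^sub>v ones_vec L))"
      unfolding interior using blocks(4) E by (intro eq_vecI) auto
    also have "E *\<^sub>v (D *\<^sub>v ones_vec L) = (E * D) *\<^sub>v ones_vec L"
      using blocks(4) E by (intro assoc_mult_mat_vec[symmetric]) auto
    finally have "w = ones_vec L"
      by (simp add: w_def ED)
    then have "Y *\<^sub>v ones_vec N @\<^sub>v 0\<^sub>v L = 0\<^sub>v N @\<^sub>v 0\<^sub>v L"
      using key Y_A_ones by (simp add: ones_vec_append M[symmetric] zero_append)
    then show "Y *\<^sub>v ones_vec N = 0\<^sub>v N"
      using Y append_vec_eq[of "Y *\<^sub>v ones_vec N" N "0\<^sub>v N"] by simp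
  next
    assume "Y *\<^sub>v ones_vec N = 0\<^sub>v N"
    then have ker: "Y_A *\<^sub>v (ones_vec N @\<^sub>v w) = 0\<^sub>v M"
      using key by (simp add: zero_append)
    have carrier: "ones_vec N @\<^sub>v w \<in> carrier_vec M"
      using w M by auto
    \<comment> \<open>Since \<open>0 < N\<close>, entry 0 lies in the boundary block and equals 1,
      whatever \<open>w\<close> is.\<close>
    have "(ones_vec N @\<^sub>v w) $ 0 \<noteq> 0\<^sub>v M $ 0"
      using boundary_nonempty M by (simp add: ones_vec_def)
    then have "\<not> invertible_mat Y_A"
      using invertible_mat_mult_vec_eq_0[OF _ Y_A carrier ker] by auto
    then show "\<forall>m<M. s m = 0"
      using shunt_nonsingular by blast
  qed
  then show ?thesis
    using shunt_iff mult_ones_vec_eq_0_iff[OF Y] by simp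
qed

end
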